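(* Let $I=(0,1)$, $g>0$, let $H\in C^1(\bar I)$ and $\tilde u\in C^2(\bar I)$ be real-valued. For any $N\geq1$, let $\{\tilde u_i\}_{1\leq i\leq N}$ and $\{H_i\}_{1\leq i\leq N}$ be the $\mathbb{P}_0$-approximations in $\lambda$ of $\tilde u$ and $H$ for $\gamma_\alpha=\frac1N$, i.e. $$\tilde u_i=N\int_{(i-1)/N}^{i/N}\tilde u(\lambda)\,\mathrm{d}\lambda,\qquad H_i=N\int_{(i-1)/N}^{i/N}H(\lambda)\,\mathrm{d}\lambda,$$ and let $A_N$ be the associated $2N\times2N$ matrix defined in the context. If $H>0$ and $\tilde u$ is strictly monotonic in $\lambda$ with $\partial_\lambda(H/\partial_\lambda\tilde u)\neq0$ for all $\lambda\in I$, then for $N$ large enough $$\sup_{c\in\sigma(A_N)}|\mathrm{Im}\,c|\leq\left(\frac{3gC^3}{N}\right)^{1/4},$$ where $C>0$ depends only on $\tilde u$ and $H$: $$C=\max\bigl(1,\|H\|_{L^\infty},\|\partial_\lambda H\|_{L^\infty},\|\tilde u\|_{L^\infty},\|\partial_\lambda\tilde u\|_{L^\infty}\bigr).$$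
   Context: $\bar I=[0,1]$. With $\boldsymbol{H}_N=(H_1,\dots,H_N)^T$, $\tilde{\boldsymbol{U}}_N=(\tilde u_1,\dots,\tilde u_N)^T$, $\boldsymbol{\gamma}_N=(\gamma_1,\dots,\gamma_N)^T=(\frac1N,\dots,\frac1N)^T$ and $\mathbf{1}_N=(1,\dots,1)^T$, $$A_N=\begin{pmatrix}\mathrm{diag}(\tilde{\boldsymbol{U}}_N)&\mathrm{diag}(\boldsymbol{H}_N)\\ g\,\mathbf{1}_N\otimes\boldsymbol{\gamma}_N&\mathrm{diag}(\tilde{\boldsymbol{U}}_N)\end{pmatrix},\qquad(\mathbf{1}_N\otimes\boldsymbol{\gamma}_N)_{ij}=\gamma_j,$$ and $\sigma(A_N)$ is the set of its (complex) eigenvalues. The expression $H/\partial_\lambda\tilde u$ presupposes $\partial_\lambda\tilde u\neq0$ on $I$. *)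

theory Defs
  imports
    "HOL-Analysis.Analysis"
    "HOL-Probability.Essential_Supremum"
    "Jordan_Normal_Form.Spectral_Radius"
begin

text \<open>\<open>Ck_on k S f\<close>: the restriction of \<open>f\<close> to \<open>S\<close> is of class \<open>C\<^sup>k\<close>. Derivatives are taken
  relative to \<open>S\<close>, so for a closed interval they are one-sided at the endpoints, and the values
  of \<open>f\<close> outside \<open>S\<close> play no role.\<close>

fun Ck_on :: "nat \<Rightarrow> real set \<Rightarrow> (real \<Rightarrow> real) \<Rightarrow> bool" where
  "Ck_on 0 S f \<longleftrightarrow> continuous_on S f"
| "Ck_on (Suc k) S f \<longleftrightarrow>
     (\<exists>f'. (\<forall>x\<in>S. (f has_real_derivative f' x) (at x within S)) \<and> Ck_on k S f')"

text \<open>The \<open>L\<^sup>\<infinity>\<close>-norm on \<open>S\<close>; the conversion to a real number is only meaningful for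
  essentially bounded measurable \<open>f\<close>.\<close>

definition Linf_norm :: "real set \<Rightarrow> (real \<Rightarrow> real) \<Rightarrow> real" where
  "Linf_norm S f =
     real_of_ereal (esssup (restrict_space lborel S) (\<lambda>x. ereal \<bar>f x\<bar>))"

text \<open>Average of \<open>f\<close> over the \<open>i\<close>-th of \<open>N\<close> equal cells of \<open>[0,1]\<close>, with \<open>i\<close> running
  from \<open>1\<close> to \<open>N\<close>.\<close>

definition P0_coeff :: "nat \<Rightarrow> (real \<Rightarrow> real) \<Rightarrow> nat \<Rightarrow> real" where
  "P0_coeff N f i = real N * integral {(real i - 1) / real N .. real i / real N} f"

text \<open>Matrix entries are indexed from \<open>0\<close>, hence the shift.\<close>

definition P0_vec :: "nat \<Rightarrow> (real \<Rightarrow> real) \<Rightarrow> real vec" where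
  "P0_vec N f = Matrix.vec N (\<lambda>i. P0_coeff N f (i + 1))"

definition uniform_weights :: "nat \<Rightarrow> real vec" where
  "uniform_weights N = Matrix.vec N (\<lambda>i. 1 / real N)"

definition multilayer_matrix ::
    "nat \<Rightarrow> real \<Rightarrow> real vec \<Rightarrow> real vec \<Rightarrow> real vec \<Rightarrow> real mat" where
  "multilayer_matrix N g \<gamma> H U =
     four_block_mat
       (mat_diag N (vec_index U))
       (mat_diag N (vec_index H))
       (g \<cdot>\<^sub>m Matrix.mat N N (\<lambda>(i, j). vec_index \<gamma> j))
       (mat_diag N (vec_index U))"

definition sigma_A :: "nat \<Rightarrow> real \<Rightarrow> (real \<Rightarrow> real) \<Rightarrow> (real \<Rightarrow> real) \<Rightarrow> complex set" where
  "sigma_A N g H u =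
     spectrum (map_mat complex_of_real
       (multilayer_matrix N g (uniform_weights N) (P0_vec N H) (P0_vec N u)))"

definition C_const :: "(real \<Rightarrow> real) \<Rightarrow> (real \<Rightarrow> real) \<Rightarrow> real" where
  "C_const H u = Max {1,
     Linf_norm {0<..<1} H, Linf_norm {0<..<1} (deriv H),
     Linf_norm {0<..<1} u, Linf_norm {0<..<1} (deriv u)}"

end

theory Submission
  imports Defs
begin

text \<open>A non-real eigenvalue \<open>c = a + ib\<close> satisfies the dispersion relation
  \<open>1/g = (1/N) \<Sum> H\<^sub>i/(u\<^sub>i - c)\<^sup>2\<close>, whose right-hand side differs from
  \<open>\<I> = \<integral> H/(u - c)\<^sup>2\<close> by at most \<open>2C\<^sup>2/(N\<bar>b\<bar>\<^sup>3)\<close>. The continuous relation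
  \<open>\<I> = 1/g\<close> has no non-real solution: with \<open>w = H/u'\<close> monotone, integration by parts shows that
  \<open>b Im ((c - e) \<I>) \<le> 0\<close>, where \<open>e\<close> is the value of \<open>u\<close> at one of the two end points, whereas
  \<open>b Im ((c - e)/g) = b\<^sup>2/g\<close>. Hence \<open>b\<^sup>4 \<le> 2gC\<^sup>2\<bar>c - e\<bar>/N\<close>. The imaginary part of the
  dispersion relation places \<open>a\<close> among the \<open>u\<^sub>i\<close>, so \<open>\<bar>a - e\<bar> \<le> C\<close>, and for large \<open>N\<close> this
  inequality itself forces \<open>\<bar>b\<bar> \<le> C/2\<close>, so that \<open>\<bar>c - e\<bar> \<le> 3C/2\<close>.\<close>

section \<open>Supremum norms and cell averages\<close>

text \<open>If \<open>r\<close> lies strictly between the essential supremum and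
  \<open>\<bar>f x\<bar>\<close>, the set where \<open>\<bar>f\<bar>\<close> exceeds
  \<open>r\<close> is open and null, hence empty, yet it contains \<open>x\<close>. The bound
  \<open>B\<close> rules out an infinite essential supremum, which \<open>real_of_ereal\<close>
  would turn into 0.\<close>

lemma abs_le_Linf_norm:
  assumes S: "open S" and f: "continuous_on S f" and B: "\<And>y. y \<in> S \<Longrightarrow> \<bar>f y\<bar> \<le> B" and x: "x \<in> S"
  shows "\<bar>f x\<bar> \<le> Linf_norm S f"
proof (rule ccontr)
  let ?M = "restrict_space lborel S"
  let ?e = "esssup ?M (\<lambda>y. ereal \<bar>f y\<bar>)"
  assume "\<not> \<bar>f x\<bar> \<le> Linf_norm S f"
  then have gt: "Linf_norm S f < \<bar>f x\<bar>" by simp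
  have [measurable]: "S \<in> sets borel" using S by simp
  have sp: "space ?M = S" by (simp add: space_restrict_space)
  have "f \<in> borel_measurable (restrict_space borel S)"
    by (rule borel_measurable_continuous_on_restrict[OF f])
  then have "f \<in> borel_measurable ?M"
    by (simp cong: measurable_cong_sets)
  then have meas: "(\<lambda>y. ereal \<bar>f y\<bar>) \<in> borel_measurable ?M" by measurable
  have lt: "?e < ereal \<bar>f x\<bar>"
  proof (cases ?e)
    case (real r)
    then show ?thesis using gt by (simp add: Linf_norm_def)
  next
    case PInf
    have "?e \<le> ereal B"
      by (rule esssup_I[OF meas]) (use B sp in auto)
    with PInf show ?thesis by simp
  qed simp
  obtain r where r: "?e < ereal r" "r < \<bar>f x\<bar>"
    using ereal_dense2[OF lt] by auto
  let ?V = "{y\<in>S. r < \<bar>f y\<bar>}"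
  have "AE y in ?M. ereal \<bar>f y\<bar> \<le> ?e" by (rule esssup_AE)
  then have "AE y in lborel. y \<in> S \<longrightarrow> ereal \<bar>f y\<bar> \<le> ?e"
    by (subst (asm) AE_restrict_space_iff) auto
  then have ae: "AE y in lborel. y \<notin> ?V"
    by (rule AE_mp) (use r in \<open>auto intro!: AE_I2 dest: le_less_trans\<close>)
  have op: "open ?V"
  proof -
    have "open (S \<inter> (\<lambda>y. \<bar>f y\<bar>) -` {r<..})"
      by (rule continuous_open_preimage) (use S f in \<open>auto intro!: continuous_intros\<close>)
    then show ?thesis by (simp add: Int_def vimage_def)
  qed
  have "?V \<in> null_sets lborel"
    using ae op by (subst (asm) AE_iff_null_sets[symmetric]) auto
  then have "negligible ?V"
    by (simp add: negligible_iff_null_sets null_sets_completionI)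
  then have "?V = {}"
    using op open_not_negligible by blast
  then show False using x r by auto
qed

text \<open>Continuity of \<open>F\<close> carries the interior bound to the end points. Two
  functions appear because \<open>deriv u\<close> is only known to agree with the continuous
  one-sided derivative of \<open>u\<close> inside the interval.\<close>

lemma abs_le_Linf_norm_Icc:
  fixes a b :: real
  assumes ab: "a < b" and F: "continuous_on {a..b} F"
    and f: "\<And>y. y \<in> {a<..<b} \<Longrightarrow> f y = F y" and x: "x \<in> {a..b}"
  shows "\<bar>F x\<bar> \<le> Linf_norm {a<..<b} f"
proof -
  have "bounded (F ` {a..b})"
    by (intro compact_imp_bounded compact_continuous_image F) simp
  then obtain B where "\<forall>z \<in> F ` {a..b}. norm z \<le> B"
    unfolding bounded_iff by blast
  then have B: "\<bar>F y\<bar> \<le> B" if "y \<in> {a..b}" for y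
    using that by auto
  have "continuous_on {a<..<b} F"
    by (rule continuous_on_subset[OF F]) auto
  then have cf: "continuous_on {a<..<b} f"
    by (rule continuous_on_eq) (simp add: f)
  have le: "\<bar>F y\<bar> \<le> Linf_norm {a<..<b} f" if y: "y \<in> {a<..<b}" for y
    using abs_le_Linf_norm[OF open_greaterThanLessThan cf, of B y] B f y by auto
  show ?thesis
  proof (rule continuous_le_on_closure[where S = "{a<..<b}" and f = "\<lambda>y. \<bar>F y\<bar>"])
    show "continuous_on (closure {a<..<b}) (\<lambda>y. \<bar>F y\<bar>)"
      using ab F by (auto intro!: continuous_intros)
    show "x \<in> closure {a<..<b}" using ab x by simp
  qed (rule le)
qed

section \<open>Averages over cells and the quadrature error\<close>

lemma P0_coeff_Suc:
  "P0_coeff N f (i + 1) = real N * integral {real i / real N .. (real i + 1) / real N} f"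
  by (simp add: P0_coeff_def add.commute)

lemma cell_subset:
  assumes "i < N"
  shows "{real i / real N .. (real i + 1) / real N} \<subseteq> {0..1}"
proof -
  have "(real i + 1) / real N \<le> 1" using assms by (simp add: divide_simps)
  moreover have "0 \<le> real i / real N" by simp
  ultimately show ?thesis by auto
qed

text \<open>The difference is the mean of \<open>f - t\<close> over the cell. It serves twice: with
  \<open>t\<close> a value of \<open>u\<close> in the same cell, and with \<open>t\<close> the value
  of \<open>u\<close> at an end point of the unit interval.\<close>

lemma abs_P0_coeff_diff_le:
  assumes N: "N > 0"
    and f: "continuous_on {real i / real N .. (real i + 1) / real N} f"
    and M: "\<And>x. x \<in> {real i / real N .. (real i + 1) / real N} \<Longrightarrow> \<bar>f x - t\<bar> \<le> M"
  shows "\<bar>P0_coeff N f (i + 1) - t\<bar> \<le> M"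
proof -
  let ?a = "real i / real N" and ?b = "(real i + 1) / real N"
  have ab: "?a \<le> ?b" "?b - ?a = 1 / real N"
    using N by (simp_all add: divide_right_mono diff_divide_distrib[symmetric])
  have "integral {?a..?b} (\<lambda>x. f x - t) = integral {?a..?b} f - t / real N"
    using ab by (subst Henstock_Kurzweil_Integration.integral_diff)
      (auto intro!: integrable_continuous_real f)
  moreover have "norm (integral {?a..?b} (\<lambda>x. f x - t)) \<le> M * (?b - ?a)"
    by (rule integral_bound) (use ab M f in \<open>auto intro!: continuous_intros\<close>)
  ultimately have "\<bar>integral {?a..?b} f - t / real N\<bar> \<le> M / real N"
    using ab by simp
  then have "real N * \<bar>integral {?a..?b} f - t / real N\<bar> \<le> M"
    using N by (simp add: field_simps)
  also have "real N * \<bar>integral {?a..?b} f - t / real N\<bar> = \<bar>real N * (integral {?a..?b} f - t / real N)\<bar>"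
    by (simp add: abs_mult)
  also have "real N * (integral {?a..?b} f - t / real N) = P0_coeff N f (i + 1) - t"
    unfolding P0_coeff_Suc using N by (simp add: field_simps)
  finally show ?thesis .
qed

lemma P0_coeff_nonneg:
  assumes "i < N" and "continuous_on {0..1} f" and "\<And>x. x \<in> {0..1} \<Longrightarrow> 0 \<le> f x"
  shows "0 \<le> P0_coeff N f (i + 1)"
proof -
  let ?K = "{real i / real N .. (real i + 1) / real N}"
  have "f integrable_on ?K"
    by (intro integrable_continuous_real continuous_on_subset[OF assms(2)] cell_subset assms(1))
  then have "0 \<le> integral ?K f"
    by (rule integral_nonneg) (use cell_subset[OF assms(1)] assms(3) in blast)
  then show ?thesis unfolding P0_coeff_Suc by simp
qed

lemma integral_cells:
  fixes h :: "real \<Rightarrow> 'a::banach"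
  assumes N: "N > 0" and h: "continuous_on {0..1} h"
  shows "integral {0..1} h = (\<Sum>i<N. integral {real i / real N .. (real i + 1) / real N} h)"
proof -
  have "(h has_integral (\<Sum>i<n. integral {real i / real N .. (real i + 1) / real N} h)) {0 .. real n / real N}"
    if "n \<le> N" for n
    using that
  proof (induction n)
    case 0
    then show ?case by (simp add: has_integral_refl)
  next
    case (Suc n)
    have "h integrable_on {real n / real N .. (real n + 1) / real N}"
      using cell_subset[of n N] Suc.prems
      by (intro integrable_continuous_real continuous_on_subset[OF h]) simp
    then have "(h has_integral integral {real n / real N .. (real n + 1) / real N} h)
        {real n / real N .. (real n + 1) / real N}"
      by (rule integrable_integral)
    from has_integral_combine[OF _ _ Suc.IH this] Suc.prems
    show ?case by (simp add: divide_right_mono add.commute)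
  qed
  from this[of N] show ?thesis using N by (simp add: integral_unique)
qed

text \<open>The averages of \<open>H\<close> reproduce the integral of \<open>H\<close> over each
  cell exactly, so the whole error comes from replacing \<open>\<psi> (u x)\<close> by its value at
  the average of \<open>u\<close>. As \<open>u\<close> varies by at most \<open>M / N\<close> within
  a cell, this costs at most \<open>L * M / N\<close> pointwise.\<close>

lemma P0_quadrature_error:
  fixes \<psi> :: "real \<Rightarrow> complex"
  assumes N: "N > 0" and H: "continuous_on {0..1} H" and B: "\<And>x. x \<in> {0..1} \<Longrightarrow> \<bar>H x\<bar> \<le> B"
    and u: "continuous_on {0..1} u"
    and M: "\<And>x y. \<lbrakk>x \<in> {0..1}; y \<in> {0..1}\<rbrakk> \<Longrightarrow> \<bar>u x - u y\<bar> \<le> M * \<bar>x - y\<bar>"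
    and \<psi>: "continuous_on UNIV \<psi>" and L: "\<And>s t. norm (\<psi> s - \<psi> t) \<le> L * \<bar>s - t\<bar>"
  shows "norm ((\<Sum>i<N. of_real (P0_coeff N H (i + 1)) * \<psi> (P0_coeff N u (i + 1))) / of_nat N
           - integral {0..1} (\<lambda>x. of_real (H x) * \<psi> (u x))) \<le> B * L * M / real N"
proof -
  define K where "K i = {real i / real N .. (real i + 1) / real N}" for i
  let ?h = "\<lambda>x. of_real (H x) * \<psi> (u x)"
  have Ksub: "K i \<subseteq> {0..1}" if "i < N" for i
    using cell_subset[OF that] by (simp add: K_def)
  have h: "continuous_on {0..1} ?h"
    by (intro continuous_intros H continuous_on_compose2[OF \<psi> u]) auto
  have M0: "0 \<le> M" using M[of 0 1] by auto
  have L0: "0 \<le> L" using order_trans[OF norm_ge_zero L[of 0 1]] by simp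
  have B0: "0 \<le> B" using B[of 0] by auto
  have len: "(real i + 1) / real N - real i / real N = 1 / real N" for i
    by (simp add: add_divide_distrib)
  have cell: "norm (of_real (P0_coeff N H (i + 1)) * \<psi> (P0_coeff N u (i + 1)) / of_nat N
      - integral (K i) ?h) \<le> B * L * M / real N * (1 / real N)" if i: "i < N" for i
  proof -
    let ?U = "P0_coeff N u (i + 1)"
    have cH: "continuous_on (K i) H" and cu: "continuous_on (K i) u" and ch: "continuous_on (K i) ?h"
      using Ksub[OF i] H u h by (auto intro: continuous_on_subset)
    have dU: "\<bar>u x - ?U\<bar> \<le> M / real N" if x: "x \<in> K i" for x
    proof -
      have "\<bar>u y - u x\<bar> \<le> M / real N" if y: "y \<in> K i" for y
      proof -
        have "\<bar>u y - u x\<bar> \<le> M * \<bar>y - x\<bar>"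
          using Ksub[OF i] x y by (intro M) auto
        also have "\<dots> \<le> M * (1 / real N)"
          using x y len[of i] M0 unfolding K_def by (intro mult_left_mono) auto
        finally show ?thesis by simp
      qed
      then show ?thesis
        using abs_P0_coeff_diff_le[OF N, of i u "u x" "M / real N"] cu
        by (auto simp: K_def abs_minus_commute)
    qed
    have "(H has_integral integral (K i) H) (K i)"
      using cH unfolding K_def by (intro integrable_integral integrable_continuous_real)
    then have "((\<lambda>x. complex_of_real (H x)) has_integral of_real (integral (K i) H)) (K i)"
      by (rule has_integral_of_real)
    then have i1: "((\<lambda>x. complex_of_real (H x) * \<psi> ?U) has_integral of_real (integral (K i) H) * \<psi> ?U) (K i)"
      by (rule has_integral_mult_left)
    \<comment> \<open>The factor \<open>N\<close> of the average cancels the weight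
      \<open>1 / N\<close>.\<close>
    have i2: "of_real (integral (K i) H) * \<psi> ?U = of_real (P0_coeff N H (i + 1)) * \<psi> ?U / of_nat N"
      using N unfolding P0_coeff_Suc K_def by simp
    have "(?h has_integral integral (K i) ?h) (K i)"
      using ch unfolding K_def by (intro integrable_integral integrable_continuous_real)
    from has_integral_diff[OF i1 this]
    have "((\<lambda>x. complex_of_real (H x) * \<psi> ?U - ?h x) has_integral
        of_real (P0_coeff N H (i + 1)) * \<psi> ?U / of_nat N - integral (K i) ?h) (K i)"
      by (simp only: i2)
    then have "norm (of_real (P0_coeff N H (i + 1)) * \<psi> ?U / of_nat N - integral (K i) ?h)
        = norm (integral (K i) (\<lambda>x. complex_of_real (H x) * \<psi> ?U - ?h x))"
      by (simp add: integral_unique)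
    also have "\<dots> \<le> B * L * M / real N * ((real i + 1) / real N - real i / real N)"
      unfolding K_def
    proof (rule integral_bound)
      show "real i / real N \<le> (real i + 1) / real N" by (simp add: divide_right_mono)
      show "continuous_on {real i / real N..(real i + 1) / real N} (\<lambda>x. complex_of_real (H x) * \<psi> ?U - ?h x)"
        using continuous_on_diff[OF continuous_on_mult_right[OF continuous_on_of_real[OF cH]] ch]
        unfolding K_def .
      fix x assume "x \<in> {real i / real N..(real i + 1) / real N}"
      then have x: "x \<in> K i" by (simp add: K_def)
      have "norm (complex_of_real (H x) * \<psi> ?U - ?h x) = \<bar>H x\<bar> * norm (\<psi> ?U - \<psi> (u x))"
        by (simp add: norm_mult right_diff_distrib[symmetric])
      also have "\<dots> \<le> B * (L * (M / real N))"
      proof (intro mult_mono)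
        show "\<bar>H x\<bar> \<le> B" using B Ksub[OF i] x by auto
        have "norm (\<psi> ?U - \<psi> (u x)) \<le> L * \<bar>?U - u x\<bar>" by (rule L)
        also have "\<dots> \<le> L * (M / real N)"
          using dU[OF x] L0 by (intro mult_left_mono) (auto simp: abs_minus_commute)
        finally show "norm (\<psi> ?U - \<psi> (u x)) \<le> L * (M / real N)" .
      qed (use B0 in auto)
      finally show "norm (complex_of_real (H x) * \<psi> ?U - ?h x) \<le> B * L * M / real N"
        by (simp add: algebra_simps)
    qed
    finally show ?thesis by (simp only: len)
  qed
  have "(\<Sum>i<N. of_real (P0_coeff N H (i + 1)) * \<psi> (P0_coeff N u (i + 1))) / of_nat N - integral {0..1} ?h
      = (\<Sum>i<N. of_real (P0_coeff N H (i + 1)) * \<psi> (P0_coeff N u (i + 1)) / of_nat N - integral (K i) ?h)"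
    by (simp add: integral_cells[OF N h] K_def sum_divide_distrib sum_subtractf)
  also have "norm \<dots> \<le> (\<Sum>i<N. B * L * M / real N * (1 / real N))"
    by (rule sum_norm_le) (use cell in auto)
  also have "\<dots> = B * L * M / real N" using N by simp
  finally show ?thesis .
qed

section \<open>The dispersion relation\<close>

lemma multilayer_matrix_carrier:
  assumes "H \<in> carrier_vec N" "U \<in> carrier_vec N"
  shows "multilayer_matrix N g \<gamma> H U \<in> carrier_mat (N + N) (N + N)"
  unfolding multilayer_matrix_def by simp

text \<open>Split an eigenvector into halves \<open>x\<close> and \<open>y\<close>. Since
  \<open>Im c\<close> is nonzero, every \<open>d i\<close> is invertible, and the two block rows
  express \<open>y\<close> and then \<open>x\<close> through the single number \<open>S\<close>.
  Inserting \<open>x\<close> into the definition of \<open>S\<close> gives \<open>S\<close> times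
  the claimed identity, and \<open>S = 0\<close> would make the eigenvector vanish.\<close>

lemma multilayer_dispersion_relation:
  assumes c: "c \<in> spectrum (map_mat complex_of_real (multilayer_matrix N g \<gamma> H U))" and im: "Im c \<noteq> 0"
    and H: "H \<in> carrier_vec N" and U: "U \<in> carrier_vec N"
  shows "of_real g * (\<Sum>i<N. of_real (vec_index \<gamma> i * vec_index H i) / (of_real (vec_index U i) - c)\<^sup>2) = 1"
proof -
  let ?A = "map_mat complex_of_real (multilayer_matrix N g \<gamma> H U)"
  have A: "?A \<in> carrier_mat (N + N) (N + N)"
    using multilayer_matrix_carrier[OF H U] by simp
  from c obtain v where v: "v \<in> carrier_vec (N + N)" "v \<noteq> 0\<^sub>v (N + N)" "?A *\<^sub>v v = c \<cdot>\<^sub>v v"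
    using A by (auto simp: spectrum_def eigenvalue_def eigenvector_def)
  define x where "x i = vec_index v i" for i
  define y where "y i = vec_index v (N + i)" for i
  define S where "S = (\<Sum>j<N. of_real (vec_index \<gamma> j) * x j)"
  define d where "d i = complex_of_real (vec_index U i) - c" for i
  have d: "d i \<noteq> 0" for i
    using im by (auto simp: d_def complex_eq_iff)
  have row: "(\<Sum>j<N. ?A $$ (i, j) * x j) + (\<Sum>j<N. ?A $$ (i, N + j) * y j) = c * vec_index v i"
    if i: "i < N + N" for i
  proof -
    have "c * vec_index v i = vec_index (?A *\<^sub>v v) i"
      using v i by simp
    also have "\<dots> = (\<Sum>j = 0..<N + N. ?A $$ (i, j) * vec_index v j)"
      using A v(1) i by (simp add: scalar_prod_def)
    also have "\<dots> = (\<Sum>j = 0..<N. ?A $$ (i, j) * vec_index v j) + (\<Sum>j = N..<N + N. ?A $$ (i, j) * vec_index v j)"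
      by (rule sum.atLeastLessThan_concat[symmetric]) auto
    also have "(\<Sum>j = N..<N + N. ?A $$ (i, j) * vec_index v j) = (\<Sum>j<N. ?A $$ (i, N + j) * y j)"
      using sum.shift_bounds_nat_ivl[of "\<lambda>j. ?A $$ (i, j) * vec_index v j" 0 N N]
      by (simp add: y_def atLeast0LessThan add.commute)
    finally show ?thesis by (simp add: x_def atLeast0LessThan)
  qed
  have delta: "(\<Sum>j<N. complex_of_real (if i = j then a j else 0) * z j) = of_real (a i) * z i"
    if "i < N" for i :: nat and a :: "nat \<Rightarrow> real" and z
    using that by (subst sum.remove[of _ i]) (auto intro!: sum.neutral)
  have top: "d i * x i + of_real (vec_index H i) * y i = 0" if i: "i < N" for i
  proof -
    have 1: "(\<Sum>j<N. ?A $$ (i, j) * x j) = of_real (vec_index U i) * x i"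
      unfolding delta[OF i, of "vec_index U" x, symmetric]
      using i by (intro sum.cong) (auto simp: multilayer_matrix_def mat_diag_def)
    have 2: "(\<Sum>j<N. ?A $$ (i, N + j) * y j) = of_real (vec_index H i) * y i"
      unfolding delta[OF i, of "vec_index H" y, symmetric]
      using i by (intro sum.cong) (auto simp: multilayer_matrix_def mat_diag_def)
    have "of_real (vec_index U i) * x i + of_real (vec_index H i) * y i = c * x i"
      using row[of i, unfolded 1 2] i by (simp add: x_def)
    then show ?thesis by (simp add: d_def algebra_simps)
  qed
  \<comment> \<open>The lower left block has equal rows, so it contributes the same number
    \<open>g S\<close> to each equation.\<close>
  have bot: "of_real g * S + d i * y i = 0" if i: "i < N" for i
  proof -
    have 1: "(\<Sum>j<N. ?A $$ (N + i, j) * x j) = of_real g * S"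
      unfolding S_def sum_distrib_left
      using i by (intro sum.cong) (auto simp: multilayer_matrix_def mat_diag_def)
    have 2: "(\<Sum>j<N. ?A $$ (N + i, N + j) * y j) = of_real (vec_index U i) * y i"
      unfolding delta[OF i, of "vec_index U" y, symmetric]
      using i by (intro sum.cong) (auto simp: multilayer_matrix_def mat_diag_def)
    have "of_real g * S + of_real (vec_index U i) * y i = c * y i"
      using row[of "N + i", unfolded 1 2] i by (simp add: y_def)
    then show ?thesis by (simp add: d_def algebra_simps)
  qed
  have y: "y i = - (of_real g * S / d i)" if "i < N" for i
    using bot[OF that] d[of i] by (simp add: field_simps add_eq_0_iff)
  have x: "x i = of_real g * S * (of_real (vec_index H i) / (d i)\<^sup>2)" if "i < N" for i
  proof -
    have "d i * x i = of_real (vec_index H i) * (of_real g * S / d i)"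
      using top[OF that] y[OF that] by simp
    then have "x i = of_real (vec_index H i) * (of_real g * S / d i) / d i"
      using d[of i] by (simp add: field_simps)
    then show ?thesis by (simp add: power2_eq_square)
  qed
  have "S \<noteq> 0"
  proof
    assume "S = 0"
    then have "vec_index v i = 0" if "i < N + N" for i
      using x[of i] y[of "i - N"] that by (cases "i < N") (auto simp: x_def y_def)
    then have "v = 0\<^sub>v (N + N)" using v(1) by (intro eq_vecI) auto
    with v(2) show False by simp
  qed
  moreover have "S = S * (of_real g * (\<Sum>i<N. of_real (vec_index \<gamma> i * vec_index H i) / (d i)\<^sup>2))"
  proof -
    have "(\<Sum>j<N. of_real (vec_index \<gamma> j) * x j) =
        (\<Sum>i<N. of_real g * S * (of_real (vec_index \<gamma> i * vec_index H i) / (d i)\<^sup>2))"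
      by (intro sum.cong) (simp_all add: x)
    then show ?thesis unfolding S_def[symmetric] by (simp add: sum_distrib_left mult.assoc mult.left_commute)
  qed
  ultimately show ?thesis by (simp add: d_def)
qed

section \<open>The continuous dispersion relation\<close>

text \<open>With p = s - c and q = t - c, the difference factors as (q - p)(1/(p q^2) + 1/(p^2 q)),
  and both |p| and |q| are at least |Im c|. This is the Lipschitz constant used in the quadrature
  error.\<close>

lemma norm_inverse_square_diff_le:
  fixes s t :: real
  assumes "Im c \<noteq> 0"
  shows "norm (1 / (of_real s - c)\<^sup>2 - 1 / (of_real t - c)\<^sup>2) \<le> 2 / \<bar>Im c\<bar> ^ 3 * \<bar>s - t\<bar>"
proof -
  let ?p = "of_real s - c" and ?q = "of_real t - c" and ?b = "\<bar>Im c\<bar>"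
  have pq: "?p \<noteq> 0" "?q \<noteq> 0" using assms by (auto simp: complex_eq_iff)
  have b: "?b > 0" using assms by simp
  have np: "?b \<le> norm ?p" "?b \<le> norm ?q"
    using abs_Im_le_cmod[of ?p] abs_Im_le_cmod[of ?q] by auto
  have "?q - ?p = of_real (t - s)" by simp
  then have st: "norm (?q - ?p) = \<bar>s - t\<bar>"
    by (metis norm_of_real real_norm_def abs_minus_commute)
  have "1 / ?p\<^sup>2 - 1 / ?q\<^sup>2 = (?q - ?p) * (1 / (?p * ?q\<^sup>2) + 1 / (?p\<^sup>2 * ?q)) "
    using pq by (simp add: divide_simps) (simp add: power2_eq_square algebra_simps)
  also have "norm \<dots> = \<bar>s - t\<bar> * norm (1 / (?p * ?q\<^sup>2) + 1 / (?p\<^sup>2 * ?q))"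
    by (simp only: norm_mult st)
  also have "\<dots> \<le> \<bar>s - t\<bar> * (1 / ?b ^ 3 + 1 / ?b ^ 3)"
  proof (intro mult_left_mono norm_triangle_le add_mono)
    have "?b * ?b\<^sup>2 \<le> norm ?p * (norm ?q)\<^sup>2" "?b\<^sup>2 * ?b \<le> (norm ?p)\<^sup>2 * norm ?q"
      using np b by (intro mult_mono power_mono; simp)+
    then have 1: "?b ^ 3 \<le> norm (?p * ?q\<^sup>2)" and 2: "?b ^ 3 \<le> norm (?p\<^sup>2 * ?q)"
      by (simp_all add: norm_mult norm_power power3_eq_cube power2_eq_square mult.assoc)
    show "norm (1 / (?p * ?q\<^sup>2)) \<le> 1 / ?b ^ 3"
      unfolding norm_divide norm_one by (rule frac_le[OF _ _ _ 1]) (use b in simp_all)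
    show "norm (1 / (?p\<^sup>2 * ?q)) \<le> 1 / ?b ^ 3"
      unfolding norm_divide norm_one by (rule frac_le[OF _ _ _ 2]) (use b in simp_all)
  qed auto
  finally show ?thesis by (simp add: mult.commute)
qed

text \<open>The quotient formula for imaginary parts, using |s - c|^4 = ((s - Re c)^2 + (Im c)^2)^2.
  The right-hand side is (Im c)^2 times the derivative in \<open>s\<close> of (e - s)/|s - c|^2,
  which is what makes integration by parts possible.\<close>

lemma Im_dispersion_kernel:
  fixes s e :: real
  assumes "Im c \<noteq> 0"
  shows "Im c * Im ((c - of_real e) / (of_real s - c)\<^sup>2) =
    (Im c)\<^sup>2 * ((s - Re c)\<^sup>2 - (Im c)\<^sup>2 + 2 * (Re c - e) * (s - Re c)) / ((s - Re c)\<^sup>2 + (Im c)\<^sup>2)\<^sup>2"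
proof -
  let ?r = "s - Re c" and ?b = "Im c"
  have "Re ((of_real s - c)\<^sup>2) = ?r\<^sup>2 - ?b\<^sup>2" "Im ((of_real s - c)\<^sup>2) = - 2 * ?r * ?b"
    by (simp_all add: power2_eq_square algebra_simps)
  moreover have "(?r\<^sup>2 - ?b\<^sup>2)\<^sup>2 + (- 2 * ?r * ?b)\<^sup>2 = (?r\<^sup>2 + ?b\<^sup>2)\<^sup>2"
    by (simp add: power2_eq_square algebra_simps)
  ultimately have "Im ((c - of_real e) / (of_real s - c)\<^sup>2)
      = (?b * (?r\<^sup>2 - ?b\<^sup>2) - (Re c - e) * (- 2 * ?r * ?b)) / (?r\<^sup>2 + ?b\<^sup>2)\<^sup>2"
    by (simp only: Im_divide) simp
  then show ?thesis by (simp add: power2_eq_square algebra_simps)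
qed

text \<open>The integrand is bounded by the derivative of \<open>w (e - u) / \<bar>u - c\<bar>\<^sup>2\<close>.\<close>

lemma Im_dispersion_integral_le_0:
  fixes H u u' w w' :: "real \<Rightarrow> real" and e \<alpha> \<beta> :: real
  assumes im: "Im c \<noteq> 0" and ab: "\<alpha> \<le> \<beta>"
    and H: "continuous_on {\<alpha>..\<beta>} H"
    and u: "\<And>x. x \<in> {\<alpha>..\<beta>} \<Longrightarrow> (u has_real_derivative u' x) (at x)"
    and w: "\<And>x. x \<in> {\<alpha>..\<beta>} \<Longrightarrow> (w has_real_derivative w' x) (at x)"
    and Hw: "\<And>x. x \<in> {\<alpha>..\<beta>} \<Longrightarrow> H x = w x * u' x"
    and w': "\<And>x. x \<in> {\<alpha>..\<beta>} \<Longrightarrow> w' x * (e - u x) \<ge> 0"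
    and w\<alpha>: "w \<alpha> * (e - u \<alpha>) \<ge> 0" and w\<beta>: "w \<beta> * (e - u \<beta>) \<le> 0"
  shows "Im c * Im ((c - of_real e) * integral {\<alpha>..\<beta>} (\<lambda>x. of_real (H x) / (of_real (u x) - c)\<^sup>2)) \<le> 0"
proof -
  let ?h = "\<lambda>x. of_real (H x) / (of_real (u x) - c)\<^sup>2"
  let ?k = "\<lambda>x. Im c * Im ((c - of_real e) * ?h x)"
  define D where "D x = (u x - Re c)\<^sup>2 + (Im c)\<^sup>2" for x
  define G where "G x = (Im c)\<^sup>2 * (w x * (e - u x) / D x)" for x
  have D: "D x > 0" for x
    using im unfolding D_def by (intro add_nonneg_pos) auto
  have cu: "continuous_on {\<alpha>..\<beta>} u"
    by (rule DERIV_continuous_on) (use u in \<open>auto intro: has_field_derivative_at_within\<close>)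
  have nz: "complex_of_real s \<noteq> c" for s
    using im by (auto simp: complex_eq_iff)
  have ch: "continuous_on {\<alpha>..\<beta>} ?h"
    by (intro continuous_intros H cu) (simp add: nz)
  then have "(?h has_integral integral {\<alpha>..\<beta>} ?h) {\<alpha>..\<beta>}"
    by (intro integrable_integral integrable_continuous_real)
  then have "((\<lambda>x. (c - of_real e) * ?h x) has_integral (c - of_real e) * integral {\<alpha>..\<beta>} ?h) {\<alpha>..\<beta>}"
    by (rule has_integral_mult_right)
  then have "((\<lambda>x. Im ((c - of_real e) * ?h x)) has_integral Im ((c - of_real e) * integral {\<alpha>..\<beta>} ?h)) {\<alpha>..\<beta>}"
    by (rule has_integral_Im)
  then have I: "(?k has_integral Im c * Im ((c - of_real e) * integral {\<alpha>..\<beta>} ?h)) {\<alpha>..\<beta>}"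
    by (rule has_integral_mult_right)
  have k: "?k x = (Im c)\<^sup>2 * (H x * ((u x - Re c)\<^sup>2 - (Im c)\<^sup>2 + 2 * (Re c - e) * (u x - Re c))) / (D x)\<^sup>2" for x
  proof -
    have "(c - of_real e) * ?h x = of_real (H x) * ((c - of_real e) / (of_real (u x) - c)\<^sup>2)"
      by simp
    moreover have "Im (of_real r * z) = r * Im z" for r z by simp
    ultimately have "?k x = H x * (Im c * Im ((c - of_real e) / (of_real (u x) - c)\<^sup>2))"
      by (simp only: mult.left_commute)
    then show ?thesis
      by (simp only: Im_dispersion_kernel[OF im] D_def) simp
  qed
  \<comment> \<open>Product rule: since \<open>H = w u'\<close>, the part of the derivative of
    \<open>G\<close> in which \<open>w\<close> is not differentiated is exactly the integrand; the
    remainder carries \<open>w'\<close> and is nonnegative by hypothesis.\<close>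
  have dG: "(G has_real_derivative ?k x + (Im c)\<^sup>2 * (w' x * (e - u x) / D x)) (at x)"
    if x: "x \<in> {\<alpha>..\<beta>}" for x
  proof -
    have nzD: "(u x - Re c)\<^sup>2 + (Im c)\<^sup>2 \<noteq> 0" using D[of x] unfolding D_def by linarith
    show ?thesis
      unfolding G_def k unfolding D_def Hw[OF x]
      apply (rule derivative_eq_intros u[OF x] w[OF x] refl nzD)+
      using im nzD by (simp add: divide_simps) (simp add: power2_eq_square algebra_simps)
  qed
  have "((\<lambda>x. ?k x + (Im c)\<^sup>2 * (w' x * (e - u x) / D x)) has_integral G \<beta> - G \<alpha>) {\<alpha>..\<beta>}"
    by (rule fundamental_theorem_of_calculus[OF ab],
        unfold has_real_derivative_iff_has_vector_derivative[symmetric])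
      (rule has_field_derivative_at_within[OF dG])
  from I this have "Im c * Im ((c - of_real e) * integral {\<alpha>..\<beta>} ?h) \<le> G \<beta> - G \<alpha>"
  proof (rule has_integral_le)
    fix x assume "x \<in> {\<alpha>..\<beta>}"
    then show "?k x \<le> ?k x + (Im c)\<^sup>2 * (w' x * (e - u x) / D x)"
      using w'[of x] D[of x] by simp
  qed
  also have "\<dots> \<le> 0"
  proof -
    have "G \<beta> \<le> 0" unfolding G_def using w\<beta> D[of \<beta>] by (simp add: mult_nonneg_nonpos divide_nonpos_pos)
    moreover have "G \<alpha> \<ge> 0" unfolding G_def using w\<alpha> D[of \<alpha>] by simp
    ultimately show ?thesis by simp
  qed
  finally show ?thesis .
qed

text \<open>The image of \<open>S\<close> is connected and avoids 0. This fixes the signs of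
  \<open>u'\<close> and of the derivative of \<open>H / u'\<close> on the open interval.\<close>

lemma continuous_nonzero_constant_sign:
  fixes f :: "'a::topological_space \<Rightarrow> real"
  assumes "connected S" "continuous_on S f" and nz: "\<And>x. x \<in> S \<Longrightarrow> f x \<noteq> 0"
  shows "(\<forall>x\<in>S. 0 < f x) \<or> (\<forall>x\<in>S. f x < 0)"
proof (rule ccontr)
  assume "\<not> ?thesis"
  then obtain x y where xy: "x \<in> S" "y \<in> S" "f x \<le> 0" "0 \<le> f y"
    by (auto simp: not_less)
  have "connected (f ` S)"
    by (rule connected_continuous_image) fact+
  from connectedD_interval[OF this, of "f x" "f y" 0] xy have "0 \<in> f ` S" by auto
  with nz show False by auto
qed

text \<open>The slope \<open>H / u'\<close> may blow up at the end points, so the sign is first established on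
  compact subintervals.\<close>

lemma Im_dispersion_integral_endpoint:
  fixes H u u' w' :: "real \<Rightarrow> real"
  assumes im: "Im c \<noteq> 0"
    and H: "continuous_on {0..1} H" and Hpos: "\<And>x. x \<in> {0<..<1} \<Longrightarrow> 0 < H x"
    and u: "continuous_on {0..1} u"
    and u': "\<And>x. x \<in> {0<..<1} \<Longrightarrow> (u has_real_derivative u' x) (at x)"
      "continuous_on {0<..<1} u'" "\<And>x. x \<in> {0<..<1} \<Longrightarrow> u' x \<noteq> 0"
    and w': "\<And>x. x \<in> {0<..<1} \<Longrightarrow> ((\<lambda>x. H x / u' x) has_real_derivative w' x) (at x)"
      "continuous_on {0<..<1} w'" "\<And>x. x \<in> {0<..<1} \<Longrightarrow> w' x \<noteq> 0"
  obtains p where "p \<in> {0, 1}"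
    "Im c * Im ((c - of_real (u p)) *
       integral {0..1} (\<lambda>x. of_real (H x) / (of_real (u x) - c)\<^sup>2)) \<le> 0"
proof -
  let ?h = "\<lambda>x. of_real (H x) / (of_real (u x) - c)\<^sup>2"
  define Z where "Z e \<alpha> \<beta> = Im c * Im ((c - of_real e) * integral {\<alpha>..\<beta>} ?h)" for e \<alpha> \<beta>
  have u'_sign: "(\<forall>x\<in>{0<..<1}. 0 < u' x) \<or> (\<forall>x\<in>{0<..<1}. u' x < 0)"
    by (rule continuous_nonzero_constant_sign) (use u' in auto)
  have w'_sign: "(\<forall>x\<in>{0<..<1}. 0 < w' x) \<or> (\<forall>x\<in>{0<..<1}. w' x < 0)"
    by (rule continuous_nonzero_constant_sign) (use w' in auto)
  \<comment> \<open>The product form covers increasing and decreasing \<open>u\<close> at once;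
    \<open>z\<close> may be any interior point because \<open>u'\<close> has one sign.\<close>
  have mono: "0 \<le> (u y - u x) * u' z" if "0 < x" "x \<le> y" "y < 1" "z \<in> {0<..<1}" for x y z
    using u'_sign
  proof
    assume pos: "\<forall>x\<in>{0<..<1}. 0 < u' x"
    have "u x \<le> u y"
    proof (rule DERIV_nonneg_imp_nondecreasing[OF \<open>x \<le> y\<close>])
      fix t assume "x \<le> t" "t \<le> y"
      then have "t \<in> {0<..<1}" using that by auto
      then show "\<exists>d. (u has_real_derivative d) (at t) \<and> 0 \<le> d"
        using u'(1) pos less_imp_le by blast
    qed
    with pos that show ?thesis by (simp add: less_imp_le)
  next
    assume neg: "\<forall>x\<in>{0<..<1}. u' x < 0"
    have "u y \<le> u x"
    proof (rule DERIV_nonpos_imp_nonincreasing[OF \<open>x \<le> y\<close>])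
      fix t assume "x \<le> t" "t \<le> y"
      then have "t \<in> {0<..<1}" using that by auto
      then show "\<exists>d. (u has_real_derivative d) (at t) \<and> d \<le> 0"
        using u'(1) neg less_imp_le by blast
    qed
    with neg that show ?thesis by (simp add: mult_nonpos_nonpos less_imp_le)
  qed
  \<comment> \<open>Since \<open>H\<close> is positive, \<open>H / u'\<close> has the sign of
    \<open>u'\<close>.\<close>
  have mono_w: "0 \<le> (u y - u x) * (H z / u' z)" if "0 < x" "x \<le> y" "y < 1" "z \<in> {0<..<1}" for x y z
  proof -
    have "(u y - u x) * (H z / u' z) = (u y - u x) * u' z * (H z / (u' z)\<^sup>2)"
      using u'(3)[OF that(4)] by (simp add: power2_eq_square)
    also have "\<dots> \<ge> 0"
      by (rule mult_nonneg_nonneg[OF mono[OF that]]) (use Hpos[OF that(4)] in simp)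
    finally show ?thesis .
  qed
  \<comment> \<open>When \<open>e\<close> is the value of \<open>u\<close> at one end of the
    subinterval, one boundary term vanishes and the other has the required sign by
    \<open>mono_w\<close>.\<close>
  have Z_le: "Z e \<alpha> \<beta> \<le> 0"
    if ab: "0 < \<alpha>" "\<alpha> \<le> \<beta>" "\<beta> < 1"
      and e: "\<And>x. x \<in> {\<alpha>..\<beta>} \<Longrightarrow> w' x * (e - u x) \<ge> 0" "e = u \<alpha> \<or> e = u \<beta>" for e \<alpha> \<beta>
    unfolding Z_def
  proof (rule Im_dispersion_integral_le_0[where u' = u' and w = "\<lambda>x. H x / u' x" and w' = w'])
    show "continuous_on {\<alpha>..\<beta>} H"
      by (rule continuous_on_subset[OF H]) (use ab in auto)
    show "0 \<le> H \<alpha> / u' \<alpha> * (e - u \<alpha>)"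
      using e(2) mono_w[of \<alpha> \<beta> \<alpha>] ab by (auto simp: mult.commute)
    have "0 \<le> (u \<beta> - u \<alpha>) * (H \<beta> / u' \<beta>)" using mono_w[of \<alpha> \<beta> \<beta>] ab by auto
    moreover have "H \<beta> / u' \<beta> * (u \<alpha> - u \<beta>) = - ((u \<beta> - u \<alpha>) * (H \<beta> / u' \<beta>))"
      by (metis minus_diff_eq minus_mult_left mult.commute)
    ultimately show "H \<beta> / u' \<beta> * (e - u \<beta>) \<le> 0"
      using e(2) by auto
  qed (use im ab u' w' e in auto)
  have nz: "complex_of_real s \<noteq> c" for s
    using im by (auto simp: complex_eq_iff)
  have ch: "continuous_on {0..1} ?h"
    by (intro continuous_intros H u) (simp add: nz)
  define J where "J x = integral {0..x} ?h" for x
  have cJ: "continuous_on {0..1} J"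
    unfolding J_def by (intro indefinite_integral_continuous_1 integrable_continuous_real ch)
  have J: "integral {t..1 - t} ?h = J (1 - t) - J t" if t: "t \<in> {0..1/2}" for t
  proof -
    have "?h integrable_on {0..1 - t}"
      by (intro integrable_continuous_real continuous_on_subset[OF ch]) (use t in auto)
    from Henstock_Kurzweil_Integration.integral_combine[OF _ _ this, of t] t show ?thesis
      by (auto simp: J_def algebra_simps)
  qed
  \<comment> \<open>Exhaust the interval by [t, 1 - t] and let t tend to 0. The reference value is a
    function \<open>f\<close> of \<open>t\<close> because it is an end value of \<open>u\<close> on
    the moving subinterval; the primitive \<open>J\<close> makes the integral continuous in
    \<open>t\<close>.\<close>
  have lim: "Z (f 0) 0 1 \<le> 0"
    if f: "continuous_on {0..1/2} f" and le: "\<And>t. t \<in> {0<..<1/2} \<Longrightarrow> Z (f t) t (1 - t) \<le> 0" for f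
  proof -
    have cl: "closure {0<..<1/2::real} = {0..1/2}" by (rule closure_greaterThanLessThan) simp
    let ?Z = "\<lambda>t. Im c * Im ((c - of_real (f t)) * (J (1 - t) - J t))"
    have "?Z 0 \<le> 0"
    proof (rule continuous_le_on_closure[where S = "{0<..<1/2}" and f = ?Z])
      show "continuous_on (closure {0<..<1/2}) ?Z"
        unfolding cl
        by (intro continuous_intros f continuous_on_compose2[OF cJ]) auto
      show "(0::real) \<in> closure {0<..<1/2}" unfolding cl by simp
      fix t :: real assume "t \<in> {0<..<1/2}"
      then show "?Z t \<le> 0"
        using le[of t] J[of t] by (simp add: Z_def)
    qed
    then show ?thesis using J[of 0] by (simp add: Z_def)
  qed
  \<comment> \<open>If \<open>w'\<close> and \<open>u'\<close> have the same sign, the right end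
    value is the correct choice: \<open>e - u\<close> then has the sign of \<open>u'\<close>, up to
    zeros, hence that of \<open>w'\<close>. With opposite signs it is the left end value.\<close>
  have same: "Z (u 1) 0 1 \<le> 0" if s: "\<And>x. x \<in> {0<..<1} \<Longrightarrow> 0 < w' x * u' x"
  proof -
    have "Z (u (1 - 0)) 0 1 \<le> 0"
    proof (rule lim)
      show "continuous_on {0..1/2} (\<lambda>t. u (1 - t))"
        by (intro continuous_on_compose2[OF u] continuous_intros) auto
      fix t :: real assume t: "t \<in> {0<..<1/2}"
      show "Z (u (1 - t)) t (1 - t) \<le> 0"
      proof (rule Z_le)
        fix x assume "x \<in> {t..1 - t}"
        with t have "0 \<le> (u (1 - t) - u x) * u' x" "0 < w' x * u' x"
          by (auto intro!: mono s)
        then show "0 \<le> w' x * (u (1 - t) - u x)"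
          by (auto simp: zero_le_mult_iff zero_less_mult_iff)
      qed (use t in auto)
    qed
    then show ?thesis by simp
  qed
  have opposite: "Z (u 0) 0 1 \<le> 0" if s: "\<And>x. x \<in> {0<..<1} \<Longrightarrow> w' x * u' x < 0"
  proof (rule lim)
    show "continuous_on {0..1/2} u"
      by (rule continuous_on_subset[OF u]) auto
    fix t :: real assume t: "t \<in> {0<..<1/2}"
    show "Z (u t) t (1 - t) \<le> 0"
    proof (rule Z_le)
      fix x assume "x \<in> {t..1 - t}"
      with t have "0 \<le> (u x - u t) * u' x" "w' x * u' x < 0"
        by (auto intro!: mono s)
      then show "0 \<le> w' x * (u t - u x)"
        by (auto simp: zero_le_mult_iff mult_less_0_iff)
    qed (use t in auto)
  qed
  have "(\<forall>x\<in>{0<..<1}. 0 < w' x * u' x) \<or> (\<forall>x\<in>{0<..<1}. w' x * u' x < 0)"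
    using u'_sign w'_sign by (auto simp: zero_less_mult_iff mult_less_0_iff)
  then show thesis
    using same opposite that[of 0] that[of 1] by (auto simp: Z_def)
qed

section \<open>Localisation of the spectrum\<close>

text \<open>The imaginary part of the relation says that the sum of h_i (s_i - Re c)/|s_i - c|^4
  vanishes. If \<open>Re c\<close> were farther than \<open>M\<close> from \<open>e\<close>, all s_i
  - Re c would share a strict sign, so all \<open>h i\<close> would be 0, contradicting
  \<open>r \<noteq> 0\<close>.\<close>

lemma dispersion_Re_bound:
  fixes h s :: "nat \<Rightarrow> real"
  assumes im: "Im c \<noteq> 0" and h: "\<And>i. i < N \<Longrightarrow> 0 \<le> h i" and s: "\<And>i. i < N \<Longrightarrow> \<bar>s i - e\<bar> \<le> M"
    and sum: "(\<Sum>i<N. of_real (h i) / (of_real (s i) - c)\<^sup>2) = of_real r" and r: "r \<noteq> 0"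
  shows "\<bar>Re c - e\<bar> \<le> M"
proof (rule ccontr)
  assume far: "\<not> \<bar>Re c - e\<bar> \<le> M"
  define D where "D i = ((s i - Re c)\<^sup>2 + (Im c)\<^sup>2)\<^sup>2" for i
  have D: "D i > 0" for i
  proof -
    have "(s i - Re c)\<^sup>2 + (Im c)\<^sup>2 > 0" using im by (intro add_nonneg_pos) auto
    then show ?thesis unfolding D_def by (rule zero_less_power)
  qed
  have Im_term: "Im (of_real (h i) / (of_real (s i) - c)\<^sup>2) = 2 * Im c * (h i * (s i - Re c) / D i)" for i
  proof -
    have "Re ((of_real (s i) - c)\<^sup>2) = (s i - Re c)\<^sup>2 - (Im c)\<^sup>2"
      "Im ((of_real (s i) - c)\<^sup>2) = - 2 * (s i - Re c) * Im c"
      by (simp_all add: power2_eq_square algebra_simps)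
    moreover have "((s i - Re c)\<^sup>2 - (Im c)\<^sup>2)\<^sup>2 + (- 2 * (s i - Re c) * Im c)\<^sup>2 = D i"
      by (simp add: D_def power2_eq_square algebra_simps)
    ultimately have "Im (of_real (h i) / (of_real (s i) - c)\<^sup>2) = - (h i * (- 2 * (s i - Re c) * Im c) / D i)"
      by (simp only: Im_divide) simp
    then show ?thesis using D[of i] by (simp add: field_simps)
  qed
  have "2 * Im c * (\<Sum>i<N. h i * (s i - Re c) / D i) = Im (of_real r)"
    unfolding sum[symmetric] Im_sum Im_term sum_distrib_left ..
  then have 0: "(\<Sum>i<N. h i * (s i - Re c) / D i) = 0" using im by simp
  have "h i = 0" if i: "i < N" for i
  proof (cases "Re c > e + M")
    case True
    have neg: "s j - Re c < 0" if "j < N" for j using s[OF that] True by linarith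
    have "(\<Sum>i<N. - (h i * (s i - Re c) / D i)) = 0"
      using 0 by (simp add: sum_negf)
    moreover have "0 \<le> - (h j * (s j - Re c) / D j)" if "j < N" for j
      using h[OF that] neg[OF that] D[of j] by (simp add: divide_nonpos_pos mult_nonneg_nonpos)
    ultimately have "- (h i * (s i - Re c) / D i) = 0"
      using sum_nonneg_eq_0_iff[of "{..<N}" "\<lambda>i. - (h i * (s i - Re c) / D i)"] i by auto
    then show ?thesis using neg[OF i] D[of i] by auto
  next
    case False
    then have "Re c < e - M" using far by linarith
    then have pos: "s j - Re c > 0" if "j < N" for j using s[OF that] by linarith
    have "0 \<le> h j * (s j - Re c) / D j" if "j < N" for j
      using h[OF that] pos[OF that] D[of j] by simp
    then have "h i * (s i - Re c) / D i = 0"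
      using 0 sum_nonneg_eq_0_iff[of "{..<N}" "\<lambda>i. h i * (s i - Re c) / D i"] i by auto
    then show ?thesis using pos[OF i] D[of i] by auto
  qed
  with sum r show False by simp
qed

text \<open>Here \<open>I\<close> stands for the continuous integral and \<open>?E\<close> for the
  quadrature error. Comparing imaginary parts after multiplication by c - e gives b^2/g \<le> b |c -
  e| |E|, that is N b^4 \<le> 2 g C^2 (C + b); it remains to absorb \<open>b\<close> into
  \<open>C\<close>.\<close>

lemma Im_fourth_power_bound:
  fixes g C e :: real and N :: nat
  assumes g: "g > 0" and C: "C \<ge> 1" and N: "real N > 48 * g" and im: "Im c \<noteq> 0"
    and sign: "Im c * Im ((c - of_real e) * I) \<le> 0"
    and err: "norm (1 / of_real g - I) \<le> 2 * C\<^sup>2 / (real N * \<bar>Im c\<bar> ^ 3)"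
    and re: "\<bar>Re c - e\<bar> \<le> C"
  shows "\<bar>Im c\<bar> ^ 4 \<le> 3 * g * C ^ 3 / real N"
proof -
  define b where "b = \<bar>Im c\<bar>"
  let ?E = "1 / of_real g - I"
  have b: "b > 0" using im by (simp add: b_def)
  have N0: "real N > 0" using N g by (smt (verit) mult_pos_pos)
  have "(c - of_real e) * I = (c - of_real e) / of_real g - (c - of_real e) * ?E"
    by (simp add: algebra_simps)
  then have "Im ((c - of_real e) * I) = Im c / g - Im ((c - of_real e) * ?E)"
    by (simp only: minus_complex.sel Im_divide_of_real) simp
  with sign have "Im c * (Im c / g) \<le> Im c * Im ((c - of_real e) * ?E)"
    by (simp add: right_diff_distrib)
  also have "\<dots> \<le> b * norm ((c - of_real e) * ?E)"
    unfolding b_def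
    by (rule order_trans[OF abs_ge_self], subst abs_mult, rule mult_left_mono[OF abs_Im_le_cmod]) simp
  also have "\<dots> \<le> b * ((C + b) * (2 * C\<^sup>2 / (real N * b ^ 3)))"
  proof -
    have "norm (c - of_real e) \<le> C + b"
      using cmod_le[of "c - of_real e"] re by (simp add: b_def)
    then show ?thesis
      using b err C unfolding norm_mult b_def[symmetric] by (intro mult_left_mono mult_mono) auto
  qed
  also have "Im c * (Im c / g) = b\<^sup>2 / g" by (simp add: b_def power2_eq_square)
  also have "b * ((C + b) * (2 * C\<^sup>2 / (real N * b ^ 3))) = 2 * C\<^sup>2 * (C + b) / (real N * b\<^sup>2)"
    using b by (simp add: power2_eq_square power3_eq_cube)
  finally have "b\<^sup>2 / g * (g * (real N * b\<^sup>2)) \<le> 2 * C\<^sup>2 * (C + b) / (real N * b\<^sup>2) * (g * (real N * b\<^sup>2))"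
    by (rule mult_right_mono) (use g in simp)
  then have "b ^ 4 * real N \<le> 2 * g * C\<^sup>2 * (C + b)"
    using b N0 g by (simp add: power2_eq_square power4_eq_xxxx mult_ac)
  \<comment> \<open>Otherwise C + b < 3b, so the previous bound yields N b^3 \<le> 6 g C^2. With C <
    2b and C \<ge> 1 this gives N \<le> 8 * 6 g = 48 g, which explains the threshold.\<close>
  moreover have "2 * b \<le> C"
  proof (rule ccontr)
    assume *: "\<not> 2 * b \<le> C"
    have "b * (b ^ 3 * real N) = b ^ 4 * real N" by (simp add: power4_eq_xxxx power3_eq_cube)
    also have "\<dots> \<le> 2 * g * C\<^sup>2 * (C + b)" by fact
    also have "\<dots> \<le> 2 * g * C\<^sup>2 * (3 * b)"
      using * g by (intro mult_left_mono) auto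
    also have "\<dots> = b * (6 * g * C\<^sup>2)" by simp
    finally have 1: "b ^ 3 * real N \<le> 6 * g * C\<^sup>2" using b by simp
    have "C\<^sup>2 * real N \<le> C ^ 3 * real N"
      using C N0 by (intro mult_right_mono power_increasing) auto
    also have "\<dots> \<le> (2 * b) ^ 3 * real N"
      using * C N0 by (intro mult_right_mono power_mono) auto
    also have "\<dots> = 8 * (b ^ 3 * real N)" by (simp add: power_mult_distrib)
    also have "\<dots> \<le> C\<^sup>2 * (48 * g)" using mult_left_mono[OF 1, of 8] by (simp add: mult_ac)
    finally have "real N \<le> 48 * g" using C by simp
    with N show False by simp
  qed
  \<comment> \<open>The factor 3/2 turns the constant 2 into the 3 of the final bound.\<close>
  then have "2 * g * C\<^sup>2 * (C + b) \<le> 2 * g * C\<^sup>2 * (3 / 2 * C)"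
    by (intro mult_left_mono) (use g in simp_all)
  ultimately have "b ^ 4 * real N \<le> 2 * g * C\<^sup>2 * (3 / 2 * C)" by (rule order_trans)
  then have "b ^ 4 * real N \<le> 3 * g * C ^ 3"
    by (simp add: power2_eq_square power3_eq_cube mult_ac)
  then show ?thesis using N0 by (simp add: b_def pos_le_divide_eq)
qed

section \<open>Bounding the non-real spectrum of the multilayer matrix for large N\<close>

theorem proposition5p10:
  fixes g :: real and H u :: "real \<Rightarrow> real"
  assumes "g > 0"
    and "Ck_on 1 {0..1} H"
    and "Ck_on 2 {0..1} u"
    and "\<forall>x\<in>{0<..<1}. H x > 0"
    and "strict_mono_on {0<..<1} u \<or> strict_antimono_on {0<..<1} u"
    and "\<forall>x\<in>{0<..<1}. deriv u x \<noteq> 0"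
    and "\<forall>x\<in>{0<..<1}. deriv (\<lambda>s. H s / deriv u s) x \<noteq> 0"
  shows "\<forall>\<^sub>F N in sequentially.
           (SUP c\<in>sigma_A N g H u. \<bar>Im c\<bar>) \<le> (3 * g * C_const H u ^ 3 / real N) powr (1 / 4)"
proof -
  define C where "C = C_const H u"
  obtain H' where H': "\<And>x. x \<in> {0..1} \<Longrightarrow> (H has_real_derivative H' x) (at x within {0..1})"
    and cH': "continuous_on {0..1} H'"
    using assms(2) by (auto simp: One_nat_def simp del: atLeastAtMost_iff)
  obtain u' u'' where u': "\<And>x. x \<in> {0..1} \<Longrightarrow> (u has_real_derivative u' x) (at x within {0..1})"
    and u'': "\<And>x. x \<in> {0..1} \<Longrightarrow> (u' has_real_derivative u'' x) (at x within {0..1})"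
    and cu'': "continuous_on {0..1} u''"
    using assms(3) by (auto simp: numeral_2_eq_2 simp del: atLeastAtMost_iff)
  have cH: "continuous_on {0..1} H" and cu: "continuous_on {0..1} u" and cu': "continuous_on {0..1} u'"
    using H' u' u'' DERIV_continuous_on by blast+
  \<comment> \<open>\<open>Ck_on\<close> supplies derivatives relative to the closed interval; in
    the interior they are two-sided and coincide with \<open>deriv\<close>.\<close>
  have at: "at x within {0..1} = at x" if "x \<in> {0<..<1}" for x :: real
    using that by (intro at_within_Icc_at) auto
  have dH: "(H has_real_derivative H' x) (at x)" and du: "(u has_real_derivative u' x) (at x)"
    and du': "(u' has_real_derivative u'' x) (at x)" if x: "x \<in> {0<..<1}" for x
    using H'[of x] u'[of x] u''[of x] at[OF x] x by auto
  have deriv_u: "deriv u x = u' x" if "x \<in> {0<..<1}" for x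
    using du[OF that] by (rule DERIV_imp_deriv)
  have u'_nz: "u' x \<noteq> 0" if "x \<in> {0<..<1}" for x
    using assms(6) deriv_u that by auto

  \<comment> \<open>The quotient rule for \<open>H / u'\<close>, considered on the open interval
    only: \<open>u'\<close> may vanish at 0 or 1.\<close>
  define w' where "w' x = (H' x * u' x - H x * u'' x) / (u' x * u' x)" for x
  have dw: "((\<lambda>s. H s / u' s) has_real_derivative w' x) (at x)" if "x \<in> {0<..<1}" for x
    unfolding w'_def by (rule DERIV_divide[OF dH du' u'_nz]) (use that in auto)
  have w'_nz: "w' x \<noteq> 0" if x: "x \<in> {0<..<1}" for x
  proof -
    have "((\<lambda>s. H s / deriv u s) has_real_derivative w' x) (at x)"
      by (rule has_field_derivative_transform_within_open[OF dw[OF x] open_greaterThanLessThan x])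
        (simp add: deriv_u)
    then have "deriv (\<lambda>s. H s / deriv u s) x = w' x" by (rule DERIV_imp_deriv)
    with assms(7) x show ?thesis by auto
  qed
  have sub: "{0<..<1} \<subseteq> {0..1::real}" by auto
  have cu'_open: "continuous_on {0<..<1} u'" by (rule continuous_on_subset[OF cu' sub])
  have cw': "continuous_on {0<..<1} w'"
    unfolding w'_def
    by (intro continuous_intros continuous_on_subset[OF _ sub] cH cH' cu' cu'') (simp add: u'_nz)

  have fin: "finite {1, Linf_norm {0<..<1} H, Linf_norm {0<..<1} (deriv H),
      Linf_norm {0<..<1} u, Linf_norm {0<..<1} (deriv u)}" by simp
  have C1: "1 \<le> C" and CH: "Linf_norm {0<..<1} H \<le> C" and Cu: "Linf_norm {0<..<1} (deriv u) \<le> C"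
    unfolding C_def C_const_def by (rule Max_ge[OF fin], simp)+
  have H_le: "\<bar>H x\<bar> \<le> C" if "x \<in> {0..1}" for x
    using abs_le_Linf_norm_Icc[OF _ cH, of H x] that CH by auto
  have u'_le: "\<bar>u' x\<bar> \<le> C" if "x \<in> {0..1}" for x
    using abs_le_Linf_norm_Icc[OF _ cu' deriv_u that] Cu by simp
  have u_lip: "\<bar>u x - u y\<bar> \<le> C * \<bar>x - y\<bar>" if "x \<in> {0..1}" "y \<in> {0..1}" for x y
    using field_differentiable_bound[of "{0..1}" u u' C x y] u' u'_le that by auto
  \<comment> \<open>Positivity in the interior leaves nonnegativity at the end points, by
    continuity.\<close>
  have H_nonneg: "0 \<le> H x" if "x \<in> {0..1}" for x
  proof (rule continuous_ge_on_closure[where S = "{0<..<1}" and f = H])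
    show "continuous_on (closure {0<..<1}) H" using cH by simp
    show "x \<in> closure {0<..<1}" using that by simp
  qed (use assms(4) in \<open>auto intro: less_imp_le\<close>)

  have Im_bound: "\<bar>Im c\<bar> ^ 4 \<le> 3 * g * C ^ 3 / real N"
    if N: "real N > 48 * g" and c: "c \<in> sigma_A N g H u" and im: "Im c \<noteq> 0" for N c
  proof -
    define \<psi> where "\<psi> s = 1 / (complex_of_real s - c)\<^sup>2" for s
    let ?I = "integral {0..1} (\<lambda>x. of_real (H x) / (of_real (u x) - c)\<^sup>2)"
    have N0: "N > 0" using N assms(1) by (cases N) auto
    \<comment> \<open>With weights \<open>1 / N\<close> the discrete relation is a quadrature sum
      for the kernel \<open>\<psi>\<close>.\<close>
    have disp: "(\<Sum>i<N. of_real (P0_coeff N H (i + 1)) * \<psi> (P0_coeff N u (i + 1))) / of_nat N = 1 / of_real g"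
    proof -
      have "of_real g * (\<Sum>i<N. of_real (vec_index (uniform_weights N) i * vec_index (P0_vec N H) i)
          / (of_real (vec_index (P0_vec N u) i) - c)\<^sup>2) = 1"
        by (rule multilayer_dispersion_relation[OF c[unfolded sigma_A_def] im]) (simp_all add: P0_vec_def)
      moreover have "(\<Sum>i<N. of_real (vec_index (uniform_weights N) i * vec_index (P0_vec N H) i)
          / (of_real (vec_index (P0_vec N u) i) - c)\<^sup>2)
          = (\<Sum>i<N. of_real (P0_coeff N H (i + 1)) * \<psi> (P0_coeff N u (i + 1))) / of_nat N"
        unfolding sum_divide_distrib
        by (intro sum.cong) (simp_all add: uniform_weights_def P0_vec_def \<psi>_def)
      ultimately show ?thesis using assms(1) by (simp add: field_simps)
    qed
    obtain p where p: "p \<in> {0, 1}" and sign: "Im c * Im ((c - of_real (u p)) * ?I) \<le> 0"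
      by (rule Im_dispersion_integral_endpoint[OF im cH _ cu du cu'_open u'_nz dw cw' w'_nz])
        (use assms(4) in auto)
    have "complex_of_real s \<noteq> c" for s using im by (auto simp: complex_eq_iff)
    then have "continuous_on UNIV \<psi>"
      unfolding \<psi>_def by (intro continuous_intros) simp
    \<comment> \<open>Both the bound for \<open>H\<close> and the Lipschitz constant of
      \<open>u\<close> are \<open>C\<close>; that of \<open>\<psi>\<close> is 2/|Im c|^3.\<close>
    from P0_quadrature_error[OF N0 cH H_le cu u_lip this norm_inverse_square_diff_le[OF im, folded \<psi>_def]]
    have err: "norm (1 / of_real g - ?I) \<le> 2 * C\<^sup>2 / (real N * \<bar>Im c\<bar> ^ 3)"
      unfolding disp by (simp add: \<psi>_def power2_eq_square mult_ac)
    \<comment> \<open>\<open>u\<close> is \<open>C\<close>-Lipschitz on an interval of length 1, so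
      each of its cell averages lies within \<open>C\<close> of the end value
      \<open>u p\<close>.\<close>
    have "\<bar>Re c - u p\<bar> \<le> C"
    proof (rule dispersion_Re_bound[OF im])
      fix i assume i: "i < N"
      show "0 \<le> P0_coeff N H (i + 1)"
        by (rule P0_coeff_nonneg[OF i cH H_nonneg])
      show "\<bar>P0_coeff N u (i + 1) - u p\<bar> \<le> C"
      proof (rule abs_P0_coeff_diff_le[OF N0])
        show "continuous_on {real i / real N..(real i + 1) / real N} u"
          by (rule continuous_on_subset[OF cu cell_subset[OF i]])
        fix x assume "x \<in> {real i / real N..(real i + 1) / real N}"
        then have x: "x \<in> {0..1}" using cell_subset[OF i] by blast
        have "\<bar>u x - u p\<bar> \<le> C * \<bar>x - p\<bar>" using x p by (intro u_lip) auto
        also have "\<dots> \<le> C * 1" using x p C1 by (intro mult_left_mono) auto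
        finally show "\<bar>u x - u p\<bar> \<le> C" by simp
      qed
    next
      show "(\<Sum>i<N. of_real (P0_coeff N H (i + 1)) / (of_real (P0_coeff N u (i + 1)) - c)\<^sup>2) = of_real (real N / g)"
        using disp N0 by (simp add: \<psi>_def field_simps)
      show "real N / g \<noteq> 0" using N0 assms(1) by simp
    qed
    with Im_fourth_power_bound[OF assms(1) C1 N im sign err] show ?thesis .
  qed

  \<comment> \<open>The threshold depends on \<open>g\<close> alone.\<close>
  have "\<forall>\<^sub>F N in sequentially. nat \<lceil>48 * g\<rceil> < N" by (rule eventually_gt_at_top)
  then show ?thesis
  proof eventually_elim
    case (elim N)
    then have N: "real N > 48 * g" by linarith
    have N0: "N > 0" using elim by simp
    show ?case
    proof (rule cSUP_least)
      \<comment> \<open>A supremum of reals is bounded by a common upper bound only for a nonempty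
        set; a complex matrix of positive size has an eigenvalue.\<close>
      show "sigma_A N g H u \<noteq> {}"
        unfolding sigma_A_def
        by (rule spectrum_non_empty[where n = "N + N"])
          (use N0 multilayer_matrix_carrier[of "P0_vec N H" N "P0_vec N u"] in \<open>auto simp: P0_vec_def\<close>)
      fix c assume c: "c \<in> sigma_A N g H u"
      show "\<bar>Im c\<bar> \<le> (3 * g * C_const H u ^ 3 / real N) powr (1 / 4)"
      proof (cases "Im c = 0")
        case False
        have "\<bar>Im c\<bar> = (\<bar>Im c\<bar> powr 4) powr (1 / 4)" by (simp only: powr_powr) simp
        also have "\<bar>Im c\<bar> powr 4 = \<bar>Im c\<bar> ^ 4" using False by (simp add: powr_numeral)
        also have "(\<bar>Im c\<bar> ^ 4) powr (1 / 4) \<le> (3 * g * C ^ 3 / real N) powr (1 / 4)"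
          by (rule powr_mono2) (use Im_bound[OF N c False] in auto)
        finally show ?thesis by (simp add: C_def)
      qed simp
    qed
  qed
qed

end
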